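(* Let $T$ be a local ring or a commutative ring, and let $n\ge 1$. Then $R=\mathbb M_n(T)$ has Property $\overline{\mathrm K}$ if and only if one of the following holds: (1) $n\in\{4,6,8,\dots\}$; (2) $n=2$ and $1_T\in \mathrm U(T)+\mathrm U(T)$; (3) $n$ is odd and $2\in \mathrm U(T)$.
   Context: Rings are associative with identity. A local ring is a nonzero, possibly noncommutative, ring whose non-units form an ideal. $\mathrm U(T)$ is the group of units of $T$, and $\mathrm U(T)+\mathrm U(T)$ is the set of sums of two units. A ring $R$ has Property $\overline{\mathrm K}$ if there exist idempotents $e,e'\in R$ such that the anti-commutator $ee'+e'e$ is a unit of $R$. *)

theory Defs
  imports "HOL-Algebra.Ideal" "Jordan_Normal_Form.VS_Connect"
begin

text \<open>
  The ground ring \<open>T\<close> is a type \<open>'a\<close> of sort \<open>{ring, monoid_mult}\<close>: associative with identity, not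
  necessarily commutative. The class \<open>ring_1\<close> is avoided because it contains the axiom \<open>0 \<noteq> 1\<close>,
  and so would exclude the zero ring, which is a commutative ring. The record of \<open>HOL-Algebra\<close>
  belonging to the type is \<open>class_ring\<close>.
\<close>

text \<open>\<^const>\<open>ideal\<close> is two-sided and \<^const>\<open>Units\<close> consists of the two-sided invertible elements.\<close>

definition local_ring :: "('a, 'b) ring_scheme \<Rightarrow> bool" where
  "local_ring R \<longleftrightarrow> ring R \<and> \<one>\<^bsub>R\<^esub> \<noteq> \<zero>\<^bsub>R\<^esub> \<and> ideal (carrier R - Units R) R"

definition idempotents :: "('a, 'b) ring_scheme \<Rightarrow> 'a set" where
  "idempotents R = {e \<in> carrier R. e \<otimes>\<^bsub>R\<^esub> e = e}"

definition property_K_bar :: "('a, 'b) ring_scheme \<Rightarrow> bool" where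
  "property_K_bar R \<longleftrightarrow>
    (\<exists>e \<in> idempotents R. \<exists>e' \<in> idempotents R. e \<otimes>\<^bsub>R\<^esub> e' \<oplus>\<^bsub>R\<^esub> e' \<otimes>\<^bsub>R\<^esub> e \<in> Units R)"

text \<open>
  This is the record \<^const>\<open>ring_mat\<close>, whose type requires \<^class>\<open>semiring_1\<close> and hence \<open>0 \<noteq> 1\<close>.
\<close>

definition matrix_ring :: "'a::{ring, monoid_mult} itself \<Rightarrow> nat \<Rightarrow> 'a mat ring" where
  "matrix_ring _ n =
    \<lparr>carrier = carrier_mat n n, mult = (*), one = 1\<^sub>m n, zero = 0\<^sub>m n n, add = (+)\<rparr>"

lemma matrix_ring_eq_ring_mat: "matrix_ring TYPE('a::ring_1) n = ring_mat TYPE('a) n ()"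
  by (simp add: matrix_ring_def ring_mat_def)

end

theory Submission
  imports Defs "HOL-Library.Function_Algebras" "HOL-Library.Z2"
begin

text \<open>
  For idempotents \<open>e, f\<close> put \<open>t = e + f\<close> and \<open>s = t - 1\<close>; then \<open>ef + fe = st = ts\<close>, so the
  anti-commutator is a unit iff both \<open>s\<close> and \<open>t\<close> are. Moreover \<open>es = sf\<close> and
  \<open>(1 - e)t = tf - 2ef\<close>. Hence \<open>e\<close> is conjugate to \<open>f\<close>, and modulo \<open>2\<close> also to \<open>1 - e\<close>. If \<open>2\<close> is
  not a unit, comparing traces (\<open>T\<close> commutative) or dimensions over the residue division ring
  (\<open>T\<close> local) forces \<open>n\<close> to be even.

  Conversely, if \<open>1 = u + v\<close> with units \<open>u, v\<close> of \<open>M_m(T)\<close>, then the idempotents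
  \<open>[1, 0; 0, 0]\<close> and \<open>[u, 1; vu, v]\<close> of \<open>M_2m(T)\<close> have the invertible anti-commutator
  \<open>[2u, 1; vu, 0]\<close>. Such \<open>u, v\<close> always exist when \<open>m \<ge> 2\<close>.
\<close>

section \<open>Linear algebra modulo \<open>N\<close> over a residue division ring\<close>

text \<open>
  The quotient by \<open>N\<close> is a vector space over the division ring of residues modulo \<open>J\<close>. It cannot be
  formed as a type, so its linear algebra is done on representatives: \<open>span\<close> below contains \<open>N\<close>,
  which makes it a closure operator with the exchange property.
\<close>

locale residue_module =
  fixes scale :: "'v::ab_group_add \<Rightarrow> 'a::{ring, monoid_mult} \<Rightarrow> 'v"
    and J :: "'a set" and N :: "'v set"
  assumes scale_add: "scale (x + y) c = scale x c + scale y c"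
    and scale_scale: "scale (scale x c) d = scale x (c * d)"
    and scale_one: "scale x 1 = x"
    and scale_distrib: "scale x (c + d) = scale x c + scale x d"
    and N_zero: "0 \<in> N"
    and N_add: "x \<in> N \<Longrightarrow> y \<in> N \<Longrightarrow> x + y \<in> N"
    and N_scale: "x \<in> N \<Longrightarrow> scale x c \<in> N"
    and scale_J: "c \<in> J \<Longrightarrow> scale x c \<in> N"
    and unit_of_notin_J: "c \<notin> J \<Longrightarrow> \<exists>d. c * d = 1"
begin

lemma scale_zero: "scale x 0 = 0"
  using scale_distrib[of x 0 0] by simp

lemma scale_minus_one: "scale x (- 1) = - x"
proof -
  have "x + scale x (- 1) = 0"
    using scale_distrib[of x 1 "- 1"] by (simp add: scale_one scale_zero)
  then show ?thesis by (metis minus_unique)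
qed

lemma scale_diff: "scale (x - y) c = scale x c - scale y c"
  using scale_add[of "x - y" y c] by (simp add: eq_diff_eq)

inductive_set span :: "'v set \<Rightarrow> 'v set" for S where
  base: "x \<in> S \<Longrightarrow> x \<in> span S"
| null: "x \<in> N \<Longrightarrow> x \<in> span S"
| add: "x \<in> span S \<Longrightarrow> y \<in> span S \<Longrightarrow> x + y \<in> span S"
| scale: "x \<in> span S \<Longrightarrow> scale x c \<in> span S"

lemma span_uminus: "x \<in> span S \<Longrightarrow> - x \<in> span S"
  using span.scale[of x S "- 1"] by (simp add: scale_minus_one)

lemma span_diff: "x \<in> span S \<Longrightarrow> y \<in> span S \<Longrightarrow> x - y \<in> span S"
  using span.add[of x S "- y"] span_uminus by simp

lemma span_cong: "x - y \<in> N \<Longrightarrow> y \<in> span S \<Longrightarrow> x \<in> span S"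
  using span.add[of "x - y" S y] span.null by simp

lemma span_subset: "S \<subseteq> span S' \<Longrightarrow> span S \<subseteq> span S'"
proof
  fix x assume "S \<subseteq> span S'" "x \<in> span S"
  then show "x \<in> span S'"
    by (induction rule: span.induct[OF \<open>x \<in> span S\<close>]) (auto intro: span.intros)
qed

lemma span_mono: "S \<subseteq> S' \<Longrightarrow> span S \<subseteq> span S'"
  by (rule span_subset) (auto intro: span.base)

lemma span_insertD: "z \<in> span (insert y S) \<Longrightarrow> \<exists>x\<in>span S. \<exists>c. z = x + scale y c"
proof (induction rule: span.induct)
  case (base x)
  show ?case
  proof (cases "x = y")
    case True
    then show ?thesis by (intro bexI[of _ 0] exI[of _ 1]) (auto simp: scale_one intro: span.null N_zero)
  next
    case False
    then show ?thesis using base by (intro bexI[of _ x] exI[of _ 0]) (auto simp: scale_zero intro: span.base)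
  qed
next
  case (null x)
  then show ?case by (intro bexI[of _ x] exI[of _ 0]) (auto simp: scale_zero intro: span.null)
next
  case (add x z)
  then obtain a b c d where "a \<in> span S" "b \<in> span S" "x = a + scale y c" "z = b + scale y d" by blast
  then show ?case
    by (intro bexI[of _ "a + b"] exI[of _ "c + d"]) (auto simp: scale_distrib ac_simps intro: span.add)
next
  case (scale x c)
  then obtain a d where "a \<in> span S" "x = a + scale y d" by blast
  then show ?case
    by (intro bexI[of _ "scale a c"] exI[of _ "d * c"]) (auto simp: scale_add scale_scale intro: span.scale)
qed

text \<open>If the coefficient of \<open>y\<close> in \<open>z\<close> lay in \<open>J\<close>, its
  contribution would lie in \<open>N\<close> and \<open>z\<close> already in \<open>span S\<close>.
  So the coefficient has a right inverse, which is what solving for \<open>y\<close> takes, since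
  scalars act on the right.\<close>

lemma span_exchange:
  assumes "z \<in> span (insert y S)" and "z \<notin> span S"
  shows "y \<in> span (insert z S)"
proof -
  obtain x c where x: "x \<in> span S" and z: "z = x + scale y c"
    using span_insertD assms(1) by blast
  have "c \<notin> J"
    using assms(2) x z scale_J span.add span.null by metis
  then obtain d where "c * d = 1" using unit_of_notin_J by blast
  then have "y = scale (z - x) d"
    using z by (simp add: scale_scale scale_one)
  moreover have "x \<in> span (insert z S)" using x span_mono[of S "insert z S"] by blast
  ultimately show ?thesis
    by (metis insertI1 span.base span.scale span_diff)
qed

definition indep :: "'v set \<Rightarrow> bool" where
  "indep S \<longleftrightarrow> (\<forall>x\<in>S. x \<notin> span (S - {x}))"

lemma indep_subset: "indep S \<Longrightarrow> S' \<subseteq> S \<Longrightarrow> indep S'"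
  unfolding indep_def using span_mono[of "S' - {x}" "S - {x}" for x] by blast

lemma indep_insert:
  assumes "indep S" and "y \<notin> span S"
  shows "indep (insert y S)"
  unfolding indep_def
proof
  fix z assume z: "z \<in> insert y S"
  have "y \<notin> S" using assms(2) span.base[of y S] by blast
  show "z \<notin> span (insert y S - {z})"
  proof (cases "z = y")
    case True
    then show ?thesis using assms(2) \<open>y \<notin> S\<close> by simp
  next
    case False
    then have "z \<in> S" and eq: "insert y S - {z} = insert y (S - {z})" using z by auto
    then have "z \<notin> span (S - {z})" using assms(1) by (simp add: indep_def)
    moreover have "insert z (S - {z}) = S" using \<open>z \<in> S\<close> by blast
    ultimately show ?thesis
      using span_exchange[of z y "S - {z}"] assms(2) unfolding eq by argo
  qed
qed

text \<open>Steinitz exchange, by induction on the number of elements of \<open>S\<close> outside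
  \<open>B\<close>. For such an element x, some y in \<open>B\<close> escapes
  \<open>span (S - {x})\<close>, since otherwise x itself would lie in that span. Replacing x by y
  keeps independence and cardinality.\<close>

lemma card_indep_le:
  assumes "finite S" and "finite B" and "indep S" and "S \<subseteq> span B"
  shows "card S \<le> card B"
  using assms(1,3,4)
proof (induction "card (S - B)" arbitrary: S rule: less_induct)
  case less
  show ?case
  proof (cases "S \<subseteq> B")
    case True
    then show ?thesis using assms(2) card_mono by blast
  next
    case False
    then obtain x where x: "x \<in> S" "x \<notin> B" by blast
    then have "x \<notin> span (S - {x})" using less.prems(2) by (simp add: indep_def)
    moreover have "x \<in> span B" using x less.prems(3) by blast
    ultimately obtain y where y: "y \<in> B" "y \<notin> span (S - {x})"
      using span_subset[of B "S - {x}"] by blast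
    let ?S = "insert y (S - {x})"
    have fresh: "y \<notin> S - {x}" using y(2) span.base[of y "S - {x}"] by blast
    have "card ?S \<le> card B"
    proof (rule less.hyps)
      have "?S - B \<subset> S - B" using x y(1) by auto
      then show "card (?S - B) < card (S - B)" using less.prems(1) by (simp add: psubset_card_mono)
      show "indep ?S" using indep_insert y(2) indep_subset[OF less.prems(2)] by blast
      show "?S \<subseteq> span B" using less.prems(3) span.base[OF y(1)] by auto
    qed (use less.prems(1) in simp)
    moreover have "card ?S = card S"
      using fresh x(1) less.prems(1) by (metis card_insert_disjoint card.remove finite_Diff)
    ultimately show ?thesis by simp
  qed
qed

text \<open>Sizes of finite independent subsets of \<open>U\<close> are bounded by
  \<open>card B\<close>. One of greatest size spans \<open>U\<close>, because a vector of
  \<open>U\<close> outside its span would enlarge it.\<close>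

lemma exists_basis:
  assumes "finite B" and "U \<subseteq> span B"
  obtains S where "S \<subseteq> U" and "finite S" and "indep S" and "U \<subseteq> span S"
proof -
  let ?P = "\<lambda>k. \<exists>S \<subseteq> U. finite S \<and> indep S \<and> card S = k"
  have "?P 0" by (intro exI[of _ "{}"]) (simp add: indep_def)
  moreover have "\<And>k. ?P k \<Longrightarrow> k \<le> card B"
    using card_indep_le[OF _ assms(1)] assms(2) by blast
  ultimately have P: "?P (Greatest ?P)" and max: "\<And>k. ?P k \<Longrightarrow> k \<le> Greatest ?P"
    using GreatestI_nat[of ?P 0 "card B"] Greatest_le_nat[of ?P _ "card B"] by blast+
  from P obtain S where S: "S \<subseteq> U" "finite S" "indep S" "card S = Greatest ?P" by blast
  have "x \<in> span S" if "x \<in> U" for x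
  proof (rule ccontr)
    assume x: "x \<notin> span S"
    then have "x \<notin> S" using span.base[of x S] by blast
    have "?P (Suc (card S))"
      using S x that \<open>x \<notin> S\<close> indep_insert by (intro exI[of _ "insert x S"]) auto
    then show False using max S(4) by fastforce
  qed
  with S that show thesis by blast
qed

text \<open>The last conjunct makes \<open>f\<close> induce a map on the quotient by
  \<open>N\<close>.\<close>

definition linear :: "('v \<Rightarrow> 'v) \<Rightarrow> bool" where
  "linear f \<longleftrightarrow> (\<forall>x y. f (x + y) = f x + f y) \<and> (\<forall>x c. f (scale x c) = scale (f x) c) \<and>
    (\<forall>x\<in>N. f x \<in> N)"

lemma linear_span:
  assumes "linear f" and "x \<in> span S" shows "f x \<in> span (f ` S)"
  using assms(2)
  by induction (use assms(1) in \<open>auto simp: linear_def intro: span.intros\<close>)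

lemma linear_diff: "linear f \<Longrightarrow> f (x - y) = f x - f y"
  unfolding linear_def by (metis add_diff_cancel diff_add_cancel)

lemma N_uminus: "x \<in> N \<Longrightarrow> - x \<in> N"
  using N_scale[of x "- 1"] by (simp add: scale_minus_one)

lemma N_diff: "x \<in> N \<Longrightarrow> y \<in> N \<Longrightarrow> x - y \<in> N"
  using N_add N_uminus by fastforce

text \<open>
  \<open>w\<close> conjugates the idempotent \<open>e\<close> to \<open>1 - e\<close> modulo \<open>N\<close>, so a basis \<open>B\<close> of the range of \<open>e\<close>
  and its image under \<open>w\<close> together form a basis of the whole space.
\<close>

lemma even_card_basis:
  assumes X: "finite X" "indep X" "\<And>x. x \<in> span X"
    and lin: "linear e" "linear w" "linear w'"
    and idem: "\<And>x. e (e x) = e x"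
    and inv: "\<And>x. w (w' x) - x \<in> N" "\<And>x. w' (w x) - x \<in> N"
    and swap: "\<And>x. w (e x) + e (w x) - w x \<in> N"
  shows "even (card X)"
proof -
  let ?f = "\<lambda>x. x - e x"
  have f: "linear ?f"
    using lin(1) N_diff unfolding linear_def
    by (simp add: diff_diff_eq ac_simps scale_diff)
  have rng: "range e \<subseteq> span X" using X by blast
  obtain B where B: "B \<subseteq> range e" "finite B" "indep B" "range e \<subseteq> span B"
    using exists_basis[OF X(1) rng] by blast
  have fixB: "e x = x" if "x \<in> B" for x using B(1) that idem by blast
  \<comment> \<open>By \<open>swap\<close> at a vector fixed by \<open>e\<close>, its image under
    \<open>w\<close> is killed by \<open>e\<close> modulo \<open>N\<close>.\<close>
  have killB: "e (w x) \<in> N" if "x \<in> B" for x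
    using swap[of x] fixB[OF that] by simp
  \<comment> \<open>Modulo \<open>N\<close>, w (w' y) is y and e y = 0, so \<open>swap\<close> at w'
    y reads w (e (w' y)) = w (w' y). Applying \<open>w'\<close> shows that \<open>e\<close> fixes w'
    y, which therefore lies in \<open>span B\<close>; then \<open>w\<close> carries it back to
    y.\<close>
  have spanW: "y \<in> span (w ` B)" if "e y = 0" for y
  proof -
    have 1: "e (w' y) - w' y \<in> N"
    proof -
      let ?x = "w' y"
      have "w' (w (e ?x) + e (w ?x) - w ?x) \<in> N" using swap lin(3) by (auto simp: linear_def)
      moreover have "w' (e (w ?x) - e y) \<in> N"
        using inv(1)[of y] lin(1,3) linear_diff[OF lin(1)] by (metis linear_def)
      moreover have "w' (w (e ?x) + e (w ?x) - w ?x) - w' (e (w ?x) - e y) = w' (w (e ?x)) - w' (w ?x)"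
        using \<open>e y = 0\<close> by (simp add: linear_diff[OF lin(3), symmetric])
      ultimately have "w' (w (e ?x)) - w' (w ?x) \<in> N" using N_diff by metis
      moreover have "e ?x - ?x = (w' (w (e ?x)) - w' (w ?x)) - (w' (w (e ?x)) - e ?x) + (w' (w ?x) - ?x)"
        by simp
      ultimately show ?thesis using inv(2) N_diff N_add by metis
    qed
    have "e (w' y) \<in> span B" using B(4) by blast
    then have "w' y \<in> span B"
      using span_cong[of "w' y" "e (w' y)"] N_uminus[OF 1] by simp
    then have "w (w' y) \<in> span (w ` B)" by (rule linear_span[OF lin(2)])
    then show ?thesis using span_cong[of y "w (w' y)"] N_uminus[OF inv(1)[of y]] by simp
  qed
  have indep0: "x \<notin> N" if "x \<in> B" for x
    using B(3) that span.null[of x] unfolding indep_def by auto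
  \<comment> \<open>\<open>w'\<close> inverts \<open>w\<close> modulo \<open>N\<close>, so
    dependences among images under \<open>w\<close> pull back to dependences in
    \<open>B\<close>.\<close>
  have pull: "x \<in> span S" if "x \<in> B" "w x \<in> span (w ` S)" for x S
  proof -
    have "w' (w x) \<in> span (w' ` w ` S)" using linear_span[OF lin(3) that(2)] .
    moreover have "w' ` w ` S \<subseteq> span S"
      using span_cong[OF inv(2) span.base] by auto
    ultimately have "w' (w x) \<in> span S" using span_subset by blast
    then show ?thesis using span_cong[of x "w' (w x)"] N_uminus[OF inv(2)[of x]] by simp
  qed
  have inj: "inj_on w B"
  proof (rule inj_onI, rule ccontr)
    fix x y assume xy: "x \<in> B" "y \<in> B" "w x = w y" "x \<noteq> y"
    then have "w x \<in> span (w ` (B - {x}))" by (auto intro!: span.base)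
    then show False using pull xy(1) B(3) unfolding indep_def by blast
  qed
  have disj: "B \<inter> w ` B = {}"
    using fixB killB indep0 by force
  \<comment> \<open>A dependence of an element of \<open>B\<close> is refuted by applying
    \<open>e\<close>, which fixes \<open>B\<close> and kills its image under \<open>w\<close> modulo
    \<open>N\<close>. For an element of the image, apply \<open>?f\<close>, the complementary
    projection, which kills \<open>B\<close> and fixes the image modulo \<open>N\<close>.\<close>
  have "indep (B \<union> w ` B)"
    unfolding indep_def
  proof
    fix x assume "x \<in> B \<union> w ` B"
    then consider "x \<in> B" | y where "y \<in> B" "x = w y" by blast
    then show "x \<notin> span (B \<union> w ` B - {x})"
    proof cases
      case 1
      show ?thesis
      proof
        assume "x \<in> span (B \<union> w ` B - {x})"
        then have "x \<in> span (e ` (B \<union> w ` B - {x}))"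
          using linear_span[OF lin(1)] fixB[OF 1] by metis
        moreover have "e ` (B \<union> w ` B - {x}) \<subseteq> span (B - {x})"
          using fixB killB by (auto intro: span.base span.null)
        ultimately show False using span_subset B(3) 1 unfolding indep_def by blast
      qed
    next
      case 2
      show ?thesis
      proof
        assume "x \<in> span (B \<union> w ` B - {x})"
        then have "?f x \<in> span (?f ` (B \<union> w ` B - {x}))"
          using linear_span[OF f] by metis
        moreover have "?f ` (B \<union> w ` B - {x}) \<subseteq> span (w ` (B - {y}))"
        proof
          fix z assume "z \<in> ?f ` (B \<union> w ` B - {x})"
          then obtain v where v: "z = ?f v" "v \<in> B \<or> v \<in> w ` B" "v \<noteq> x" by blast
          show "z \<in> span (w ` (B - {y}))"
          proof (cases "v \<in> B")
            case True
            then show ?thesis using v(1) fixB N_zero by (simp add: span.null)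
          next
            case False
            then obtain b where b: "b \<in> B" "v = w b" "b \<noteq> y" using v 2 by blast
            then have "v \<in> span (w ` (B - {y}))" by (auto intro: span.base)
            moreover have "e v \<in> span (w ` (B - {y}))" using killB b by (auto intro: span.null)
            ultimately show ?thesis using v(1) span_diff by blast
          qed
        qed
        ultimately have "?f x \<in> span (w ` (B - {y}))" using span_subset by blast
        then have "w y \<in> span (w ` (B - {y}))"
          using span.add[OF _ span.null[OF killB[OF 2(1)]]] 2 by fastforce
        then show False using pull 2 B(3) unfolding indep_def by blast
      qed
    qed
  qed
  moreover have gen: "x \<in> span (B \<union> w ` B)" for x
  proof -
    have "e x \<in> span (B \<union> w ` B)" using B(4) span_mono[of B "B \<union> w ` B"] by blast
    moreover have "e (?f x) = 0" using linear_diff[OF lin(1)] idem by simp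
    then have "?f x \<in> span (B \<union> w ` B)" using spanW span_mono[of "w ` B" "B \<union> w ` B"] by blast
    ultimately show ?thesis using span.add[of "e x" _ "?f x"] by simp
  qed
  ultimately have "card X = card (B \<union> w ` B)"
    using X B(2) card_indep_le[of X "B \<union> w ` B"] card_indep_le[of "B \<union> w ` B" X]
    by (simp add: subset_iff)
  also have "\<dots> = 2 * card B"
    using B(2) disj inj by (simp add: card_Un_disjoint card_image)
  finally show ?thesis by simp
qed

end

section \<open>Anti-commutators in a ring and their matrix form\<close>

lemma (in monoid) Units_of_commuting_product:
  assumes x: "x \<in> carrier G" and y: "y \<in> carrier G"
    and comm: "x \<otimes> y = y \<otimes> x" and unit: "x \<otimes> y \<in> Units G"
  shows "x \<in> Units G"
proof -
  let ?i = "inv (x \<otimes> y)"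
  have i: "?i \<in> carrier G" "?i \<otimes> (x \<otimes> y) = \<one>" "(x \<otimes> y) \<otimes> ?i = \<one>" using unit by auto
  \<comment> \<open>This is a right inverse of \<open>x\<close>. Commutation also supplies a left
    inverse, and the two must agree.\<close>
  have right: "x \<otimes> (y \<otimes> ?i) = \<one>" using x y i by (simp add: m_assoc)
  have left: "(?i \<otimes> y) \<otimes> x = \<one>" using x y i comm by (simp add: m_assoc)
  have "?i \<otimes> y = y \<otimes> ?i"
    using inv_unique[OF left right] x y i by simp
  then show ?thesis using right left x y i unfolding Units_def by auto
qed

text \<open>With s = e + f - 1, both e s and s f equal e f. The last equation is (1 - e) t = t f - 2
  e f rearranged to avoid subtraction.\<close>

lemma (in ring) anticommutator_unit:
  assumes e: "e \<in> idempotents R" and f: "f \<in> idempotents R"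
    and u: "e \<otimes> f \<oplus> f \<otimes> e \<in> Units R"
  obtains s t where "s \<in> Units R" and "t \<in> Units R" and "t = e \<oplus> f" and "t = s \<oplus> \<one>"
    and "e \<otimes> s = s \<otimes> f"
    and "t \<oplus> (e \<otimes> f \<oplus> e \<otimes> f) = e \<otimes> t \<oplus> t \<otimes> f"
proof -
  have ef: "e \<in> carrier R" "f \<in> carrier R" "e \<otimes> e = e" "f \<otimes> f = f"
    using e f by (auto simp: idempotents_def)
  have ee: "e \<otimes> (e \<otimes> x) = e \<otimes> x" "f \<otimes> (f \<otimes> x) = f \<otimes> x" if "x \<in> carrier R" for x
    using ef that by (metis m_assoc)+
  let ?t = "e \<oplus> f" and ?s = "e \<oplus> f \<ominus> \<one>"
  note simps = minus_eq l_distr r_distr l_minus r_minus a_ac m_assoc ee ef r_neg r_neg1 r_neg2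
  have ts: "?t \<otimes> ?s = e \<otimes> f \<oplus> f \<otimes> e" "?s \<otimes> ?t = e \<otimes> f \<oplus> f \<otimes> e"
    using ef by (simp_all add: simps minus_add)
  show thesis
  proof
    show "?s \<in> Units R" "?t \<in> Units R"
      using Units_of_commuting_product[of ?s ?t] Units_of_commuting_product[of ?t ?s] ts u ef by auto
    show "e \<otimes> ?s = ?s \<otimes> f" using ef by (simp add: simps)
    show "?t \<oplus> (e \<otimes> f \<oplus> e \<otimes> f) = e \<otimes> ?t \<oplus> ?t \<otimes> f" using ef by (simp add: simps)
    show "?t = ?s \<oplus> \<one>" using ef by (simp add: simps)
  qed simp
qed

lemma one_mult_mat:
  "(A :: 'a::{ring, monoid_mult} mat) \<in> carrier_mat nr nc \<Longrightarrow> 1\<^sub>m nr * A = A"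
  by (intro eq_matI) (auto simp: scalar_prod_def one_mat_def if_distrib[of "\<lambda>x. x * _"] cong: if_cong)

lemma mult_one_mat:
  "(A :: 'a::{ring, monoid_mult} mat) \<in> carrier_mat nr nc \<Longrightarrow> A * 1\<^sub>m nc = A"
  by (intro eq_matI) (auto simp: scalar_prod_def one_mat_def if_distrib[of "\<lambda>x. _ * x"] cong: if_cong)

lemma ring_matrix_ring: "ring (matrix_ring TYPE('a::{ring, monoid_mult}) n)"
  by (unfold_locales, insert add_inv_exists_mat)
    (auto simp: matrix_ring_def algebra_simps Units_def one_mult_mat mult_one_mat)

lemma Units_matrix_ring:
  "A \<in> Units (matrix_ring TYPE('a::{ring, monoid_mult}) n) \<longleftrightarrow>
    A \<in> carrier_mat n n \<and> (\<exists>B \<in> carrier_mat n n. B * A = 1\<^sub>m n \<and> A * B = 1\<^sub>m n)"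
  by (auto simp: Units_def matrix_ring_def)

lemma Units_class_ring:
  "(x :: 'a::{ring, monoid_mult}) \<in> Units class_ring \<longleftrightarrow> (\<exists>y. y * x = 1 \<and> x * y = 1)"
  by (auto simp: Units_def)

text \<open>The form in which the property enters the necessity proofs: \<open>S\<close> conjugates
  \<open>F\<close> to \<open>E\<close>, and modulo 2 the last equation says that \<open>T\<close>
  conjugates \<open>F\<close> to 1 - E.\<close>

lemma property_K_bar_matrix_ringE:
  assumes "property_K_bar (matrix_ring TYPE('a::{ring, monoid_mult}) n)"
  obtains E F S S' T T' :: "'a::{ring, monoid_mult} mat"
  where "E \<in> carrier_mat n n" "F \<in> carrier_mat n n" "S \<in> carrier_mat n n" "S' \<in> carrier_mat n n"
    "T \<in> carrier_mat n n" "T' \<in> carrier_mat n n"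
    and "E * E = E" "F * F = F" "S' * S = 1\<^sub>m n" "S * S' = 1\<^sub>m n" "T' * T = 1\<^sub>m n" "T * T' = 1\<^sub>m n"
    and "T = E + F" "T = S + 1\<^sub>m n" "E * S = S * F" "T + (E * F + E * F) = E * T + T * F"
proof -
  interpret ring "matrix_ring TYPE('a) n" by (rule ring_matrix_ring)
  note R = matrix_ring_def ring_record_simps monoid.simps partial_object.simps
  from assms obtain E F where EF: "E \<in> idempotents (matrix_ring TYPE('a) n)"
    "F \<in> idempotents (matrix_ring TYPE('a) n)"
    "E \<otimes>\<^bsub>matrix_ring TYPE('a) n\<^esub> F \<oplus>\<^bsub>matrix_ring TYPE('a) n\<^esub> F \<otimes>\<^bsub>matrix_ring TYPE('a) n\<^esub> E
      \<in> Units (matrix_ring TYPE('a) n)"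
    unfolding property_K_bar_def by blast
  obtain S T where ST: "S \<in> Units (matrix_ring TYPE('a) n)" "T \<in> Units (matrix_ring TYPE('a) n)"
    and eqs: "T = E + F" "T = S + 1\<^sub>m n" "E * S = S * F" "T + (E * F + E * F) = E * T + T * F"
    using anticommutator_unit[OF EF] unfolding R by metis
  from EF have "E \<in> carrier_mat n n" "F \<in> carrier_mat n n" "E * E = E" "F * F = F"
    unfolding idempotents_def R by simp_all
  moreover from ST obtain S' T' where "S \<in> carrier_mat n n" "T \<in> carrier_mat n n"
    "S' \<in> carrier_mat n n" "T' \<in> carrier_mat n n"
    "S' * S = 1\<^sub>m n" "S * S' = 1\<^sub>m n" "T' * T = 1\<^sub>m n" "T * T' = 1\<^sub>m n"
    unfolding Units_matrix_ring by blast
  ultimately show thesis using that eqs by blast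
qed

lemma property_K_bar_matrix_ringI:
  fixes E F B :: "'a::{ring, monoid_mult} mat"
  assumes "E \<in> carrier_mat n n" "F \<in> carrier_mat n n" "B \<in> carrier_mat n n"
    and "E * E = E" "F * F = F" "B * (E * F + F * E) = 1\<^sub>m n" "(E * F + F * E) * B = 1\<^sub>m n"
  shows "property_K_bar (matrix_ring TYPE('a) n)"
proof -
  have "E * F + F * E \<in> Units (matrix_ring TYPE('a) n)"
    unfolding Units_matrix_ring using assms by auto
  then show ?thesis
    unfolding property_K_bar_def idempotents_def matrix_ring_def using assms by auto
qed

section \<open>Constructions of idempotents for the sufficient conditions\<close>

lemma property_K_bar_if_two_unit:
  assumes "(1 + 1 :: 'a::{ring, monoid_mult}) \<in> Units class_ring"
  shows "property_K_bar (matrix_ring TYPE('a) n)"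
proof -
  obtain x :: 'a where "x * (1 + 1) = 1" using assms Units_class_ring by blast
  then have x: "x + x = 1" by (simp add: distrib_left)
  \<comment> \<open>Both idempotents are the identity, so their anti-commutator is 2, and the scalar
    matrix \<open>?B\<close> inverts it.\<close>
  let ?I = "1\<^sub>m n :: 'a mat" and ?B = "mat n n (\<lambda>(i, j). if i = j then x else 0)"
  have I: "?I * ?I = ?I" using one_mult_mat[of ?I n n] by simp
  have BB: "?B + ?B = ?I" using x by (intro eq_matI) auto
  have "?B * (?I + ?I) = ?B * ?I + ?B * ?I"
    by (rule mult_add_distrib_mat[of _ n n]) auto
  moreover have "(?I + ?I) * ?B = ?I * ?B + ?I * ?B"
    by (rule add_mult_distrib_mat[of _ n n]) auto
  moreover have "?B * ?I = ?B" "?I * ?B = ?B"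
    using mult_one_mat[of ?B n n] one_mult_mat[of ?B n n] by simp_all
  ultimately show ?thesis
    using BB I by (intro property_K_bar_matrix_ringI[of ?I n ?I ?B]) auto
qed

lemma property_K_bar_double:
  fixes U V :: "'a::{ring, monoid_mult} mat"
  assumes U: "U \<in> Units (matrix_ring TYPE('a) m)" and V: "V \<in> Units (matrix_ring TYPE('a) m)"
    and sum: "U + V = 1\<^sub>m m"
  shows "property_K_bar (matrix_ring TYPE('a) (m + m))"
proof -
  obtain U' V' where c [simp]: "U \<in> carrier_mat m m" "V \<in> carrier_mat m m"
    "U' \<in> carrier_mat m m" "V' \<in> carrier_mat m m"
    and inv: "U' * U = 1\<^sub>m m" "U * U' = 1\<^sub>m m" "V' * V = 1\<^sub>m m" "V * V' = 1\<^sub>m m"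
    using U V unfolding Units_matrix_ring by blast
  let ?I = "1\<^sub>m m :: 'a mat" and ?O = "0\<^sub>m m m :: 'a mat"
  define W W' where W_def: "W = V * U" and W'_def: "W' = U' * V'"
  have cW [simp]: "W \<in> carrier_mat m m" "W' \<in> carrier_mat m m"
    unfolding W_def W'_def by (simp_all add: mult_carrier_mat[of _ m m _ m])
  let ?A = "U + U"
  define Q where "Q = ?A * W'"
  have cQ [simp]: "Q \<in> carrier_mat m m"
    unfolding Q_def by (simp add: mult_carrier_mat[of _ m m _ m])
  let ?E = "four_block_mat ?I ?O ?O ?O" and ?F = "four_block_mat U ?I W V"
  \<comment> \<open>The inverse of the anti-commutator [2U, 1; W, 0]. The upper right block of the
    product vanishes exactly for Q = 2 U W'.\<close>
  let ?B = "four_block_mat ?O W' ?I (- Q)"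
  note one = one_mult_mat[of _ m m] mult_one_mat[of _ m m]
  note zero = left_mult_zero_mat[of _ m m m] right_mult_zero_mat[of _ m m m]
  have W: "W' * W = ?I" "W * W' = ?I"
  proof -
    have "W' * W = U' * ((V' * V) * U)"
      using assoc_mult_mat[of U' m m V' m W m] assoc_mult_mat[of V' m m V m U m] cW unfolding W_def W'_def by simp
    then show "W' * W = ?I" by (simp add: inv one)
    have "W * W' = V * ((U * U') * V')"
      using assoc_mult_mat[of V m m U m W' m] assoc_mult_mat[of U m m U' m V' m] cW unfolding W_def W'_def by simp
    then show "W * W' = ?I" by (simp add: inv one)
  qed
  \<comment> \<open>U + V = 1 is multiplied by U on the right and by V on the left. Together with
    \<open>WUW\<close> and \<open>sum\<close>, these are the four blocks of F F = F.\<close>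
  have UU: "U * U + W = U" "W + V * V = V"
    using add_mult_distrib_mat[of U m m V U m] mult_add_distrib_mat[of V m m U m V] sum
    by (simp_all add: one W_def)
  have WUW: "W * U + V * W = W"
  proof -
    have "W * U + V * W = V * (U * U + W)"
      using mult_add_distrib_mat[of V m m "U * U" m W] assoc_mult_mat[of V m m U m U m]
      by (simp add: mult_carrier_mat[of _ m m _ m] W_def)
    then show ?thesis by (simp add: UU W_def[symmetric])
  qed
  have mult: "four_block_mat A1 B1 C1 D1 * four_block_mat A2 B2 C2 D2 =
      four_block_mat (A1 * A2 + B1 * C2) (A1 * B2 + B1 * D2) (C1 * A2 + D1 * C2) (C1 * B2 + D1 * D2)"
    if "A1 \<in> carrier_mat m m" "B1 \<in> carrier_mat m m" "C1 \<in> carrier_mat m m" "D1 \<in> carrier_mat m m"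
      "A2 \<in> carrier_mat m m" "B2 \<in> carrier_mat m m" "C2 \<in> carrier_mat m m" "D2 \<in> carrier_mat m m"
    for A1 B1 C1 D1 A2 B2 C2 D2 :: "'a mat"
    using that by (rule mult_four_block_mat)
  have E: "?E * ?E = ?E"
    by (subst mult) (simp_all add: one)
  have F: "?F * ?F = ?F"
    by (subst mult) (simp_all add: one UU WUW sum)
  have EF: "?E * ?F + ?F * ?E = four_block_mat ?A ?I W ?O"
  proof -
    have "?E * ?F = four_block_mat U ?I ?O ?O"
      by (subst mult) (simp_all add: one zero)
    moreover have "?F * ?E = four_block_mat U ?O W ?O"
      by (subst mult) (simp_all add: one zero)
    ultimately show ?thesis
      by (simp add: add_four_block_mat[of _ m m _ m _ m])
  qed
  have Q: "?A + - Q * W = ?O"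
  proof -
    have "Q * W = ?A"
      unfolding Q_def using assoc_mult_mat[of ?A m m W' m W m] W mult_one_mat[of ?A m m] by simp
    then show ?thesis 
      using uminus_mult_left_mat[of Q W] carrier_matD[OF cQ] carrier_matD[OF cW(1)]
        add_uminus_minus_mat[of ?A m m ?A] by simp
  qed
  have "?B * four_block_mat ?A ?I W ?O = 1\<^sub>m (m + m)"
    by (subst mult) (simp_all add: one zero W Q)
  moreover have "four_block_mat ?A ?I W ?O * ?B = 1\<^sub>m (m + m)"
    by (subst mult) (simp_all add: one zero W Q_def[symmetric] add_uminus_minus_mat[of Q m m Q] minus_r_inv_mat[of Q m m])
  ultimately show ?thesis
    using E F by (intro property_K_bar_matrix_ringI[of ?E "m + m" ?F ?B]) (simp_all add: EF)
qed

text \<open>\<open>C\<close> is the companion matrix of \<open>x ^ m - x + 1\<close>, a polynomial with value \<open>1\<close> at both \<open>0\<close> and \<open>1\<close>;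
  \<open>G = C + \<dots> + C ^ (m - 1)\<close> is the inverse of \<open>1 - C\<close>.\<close>

lemma one_mat_sum_of_units:
  assumes m: "m \<ge> 2"
  obtains U V :: "'a::{ring, monoid_mult} mat"
  where "U \<in> Units (matrix_ring TYPE('a) m)" and "V \<in> Units (matrix_ring TYPE('a) m)"
    and "U + V = 1\<^sub>m m"
proof -
  \<comment> \<open>\<open>b\<close> is the Iverson bracket. In terms of unit columns, C sends e_j
    to e_(j+1) and the last one to e_1 - e_0, which encodes C ^ m = C - 1. The inverse sends e_j to
    e_(j-1) for j > 0, and e_0 to e_0 - e_(m-1). The entries of \<open>g\<close> come from
    telescoping the sum of the powers of C.\<close>
  define b :: "bool \<Rightarrow> 'a" where "b P = (if P then 1 else 0)" for P
  define c :: "nat \<Rightarrow> nat \<Rightarrow> 'a" where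
    "c i j = (if Suc j < m then b (i = Suc j) else b (i = 1) - b (i = 0))" for i j
  define c' :: "nat \<Rightarrow> nat \<Rightarrow> 'a" where
    "c' i j = (if j = 0 then b (i = 0) - b (Suc i = m) else b (Suc i = j))" for i j
  define g :: "nat \<Rightarrow> nat \<Rightarrow> 'a" where
    "g i j = b (j \<le> i) - b (i = 0)" for i j
  obtain k where k: "m = Suc (Suc k)" using m by (metis Suc_le_D numeral_2_eq_2 Suc_le_mono)
  \<comment> \<open>The product of C with an arbitrary column \<open>h\<close>, and in
    \<open>col\<close> that of an arbitrary row with C. The four matrix identities below are
    instances.\<close>
  have row: "(\<Sum>l = 0..<m. c i l * h l) =
      (if i = 0 then - h (m - 1) else if i = 1 then h 0 + h (m - 1) else h (i - 1))"
    if "i < m" for i and h :: "nat \<Rightarrow> 'a"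
  proof -
    have "(\<Sum>l = 0..<m. c i l * h l) =
        (\<Sum>l = 0..<Suc k. if i = Suc l then h l else 0) + (b (i = 1) - b (i = 0)) * h (m - 1)"
      unfolding k sum.atLeast0_lessThan_Suc[of _ "Suc k"] by (intro arg_cong2[of _ _ _ _ "(+)"] sum.cong) (auto simp: c_def b_def k)
    also have "(\<Sum>l = 0..<Suc k. if i = Suc l then h l else 0) = (if i = 0 then 0 else h (i - 1))"
      using that by (cases i) (auto simp: k)
    finally show ?thesis by (auto simp: b_def)
  qed
  have col: "(\<Sum>l = 0..<m. h l * c l j) = (if Suc j < m then h (Suc j) else h 1 - h 0)"
    if "j < m" for j and h :: "nat \<Rightarrow> 'a"
  proof (cases "Suc j < m")
    case True
    then have "(\<Sum>l = 0..<m. h l * c l j) = (\<Sum>l = 0..<m. if l = Suc j then h l else 0)"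
      by (intro sum.cong) (auto simp: c_def b_def)
    with True show ?thesis by simp
  next
    case False
    then have "(\<Sum>l = 0..<m. h l * c l j) =
        (\<Sum>l = 0..<m. (if l = 1 then h l else 0) - (if l = 0 then h l else 0))"
      by (intro sum.cong) (auto simp: c_def b_def)
    with False m show ?thesis by (simp add: sum_subtractf)
  qed
  define C C' G where "C = mat m m (\<lambda>(i, j). c i j)" and "C' = mat m m (\<lambda>(i, j). c' i j)"
    and "G = mat m m (\<lambda>(i, j). g i j)"
  note defs = C_def C'_def G_def
  have CC': "C * C' = 1\<^sub>m m"
    unfolding defs using m by (intro eq_matI) (auto simp: scalar_prod_def row c'_def b_def)
  have C'C: "C' * C = 1\<^sub>m m"
    unfolding defs using m by (intro eq_matI) (auto simp: scalar_prod_def col c'_def b_def)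
  have CG: "G - C * G = 1\<^sub>m m"
    unfolding defs using m by (intro eq_matI) (auto simp: scalar_prod_def row g_def b_def)
  have GC: "G - G * C = 1\<^sub>m m"
    unfolding defs using m by (intro eq_matI) (auto simp: scalar_prod_def col g_def b_def)
  have carr: "C \<in> carrier_mat m m" "C' \<in> carrier_mat m m" "G \<in> carrier_mat m m"
    by (auto simp: defs)
  show thesis
  proof
    show "C \<in> Units (matrix_ring TYPE('a) m)"
      unfolding Units_matrix_ring using CC' C'C carr by blast
    have "(1\<^sub>m m - C) * G = 1\<^sub>m m * G - C * G" "G * (1\<^sub>m m - C) = G * 1\<^sub>m m - G * C"
      using carr by (simp_all only: minus_mult_distrib_mat[of _ m m _ _ m] mult_minus_distrib_mat[of _ m m _ m] one_carrier_mat)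
    moreover have "1\<^sub>m m * G = G" "G * 1\<^sub>m m = G"
      using carr by (simp_all only: one_mult_mat mult_one_mat)
    ultimately have "(1\<^sub>m m - C) * G = 1\<^sub>m m" "G * (1\<^sub>m m - C) = 1\<^sub>m m"
      using CG GC by simp_all
    then show "1\<^sub>m m - C \<in> Units (matrix_ring TYPE('a) m)"
      unfolding Units_matrix_ring using carr minus_carrier_mat by blast
    show "C + (1\<^sub>m m - C) = 1\<^sub>m m"
      using carr by (intro eq_matI) auto
  qed
qed

section \<open>Odd size over a commutative ring, by traces\<close>

definition mat_trace :: "nat \<Rightarrow> 'a::comm_monoid_add mat \<Rightarrow> 'a" where
  "mat_trace n A = (\<Sum>i<n. A $$ (i, i))"

lemma mat_trace_add:
  "A \<in> carrier_mat n n \<Longrightarrow> B \<in> carrier_mat n n \<Longrightarrow> mat_trace n (A + B) = mat_trace n A + mat_trace n B"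
  by (simp add: mat_trace_def sum.distrib)

lemma mat_trace_mult_commute:
  fixes A B :: "'a::ring mat"
  assumes comm: "\<And>x y :: 'a. x * y = y * x"
    and AB: "A \<in> carrier_mat n n" "B \<in> carrier_mat n n"
  shows "mat_trace n (A * B) = mat_trace n (B * A)"
proof -
  have "mat_trace n (A * B) = (\<Sum>i<n. \<Sum>j<n. A $$ (i, j) * B $$ (j, i))"
    using AB by (simp add: mat_trace_def scalar_prod_def atLeast0LessThan)
  also have "\<dots> = (\<Sum>j<n. \<Sum>i<n. B $$ (j, i) * A $$ (i, j))"
    by (subst sum.swap) (simp add: comm[of "A $$ _"])
  also have "\<dots> = mat_trace n (B * A)"
    using AB by (simp add: mat_trace_def scalar_prod_def atLeast0LessThan)
  finally show ?thesis .
qed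

lemma mat_trace_conjugate:
  fixes A P Q :: "'a::{ring, monoid_mult} mat"
  assumes comm: "\<And>x y :: 'a. x * y = y * x"
    and AP: "A \<in> carrier_mat n n" "P \<in> carrier_mat n n" "Q \<in> carrier_mat n n"
    and QP: "Q * P = 1\<^sub>m n"
  shows "mat_trace n (P * A * Q) = mat_trace n A"
proof -
  have "mat_trace n (P * A * Q) = mat_trace n (Q * (P * A))"
    using AP by (intro mat_trace_mult_commute[OF comm]) auto
  also have "Q * (P * A) = A"
    using AP QP assoc_mult_mat[of Q n n P n A n] one_mult_mat[of A n n] by simp
  finally show ?thesis .
qed

text \<open>Multiplying T + 2 E F = E T + T F by T' on the right and taking traces gives n + 2 tr X
  = tr E + tr F with X = E F T'. As tr F = tr E and n = 2 m + 1, the element tr E - tr X - m is an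
  inverse of 2.\<close>

lemma two_unit_if_property_K_bar_comm:
  assumes comm: "\<And>x y :: 'a::{ring, monoid_mult}. x * y = y * x"
    and K: "property_K_bar (matrix_ring TYPE('a) n)" and "odd n"
  shows "(1 + 1 :: 'a) \<in> Units class_ring"
proof -
  obtain E F S S' T T' :: "'a mat"
    where c [simp]: "E \<in> carrier_mat n n" "F \<in> carrier_mat n n" "S \<in> carrier_mat n n" "S' \<in> carrier_mat n n"
      "T \<in> carrier_mat n n" "T' \<in> carrier_mat n n"
    and inv: "S' * S = 1\<^sub>m n" "S * S' = 1\<^sub>m n" "T' * T = 1\<^sub>m n" "T * T' = 1\<^sub>m n"
    and eqs: "E * S = S * F" "T + (E * F + E * F) = E * T + T * F"
    by (rule property_K_bar_matrix_ringE[OF K]) (rule that; assumption)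
  let ?tr = "mat_trace n" and ?X = "E * F * T'"
  note mc [simp] = mult_carrier_mat[of _ n n _ n]
  have "?tr F = ?tr E"
  proof -
    have "S * F * S' = E"
      using assoc_mult_mat[of E n n S n S' n] eqs(1) inv mult_one_mat[of E n n] by simp
    then show ?thesis using mat_trace_conjugate[OF comm, of F n S S'] inv by simp
  qed
  moreover have "1\<^sub>m n + (?X + ?X) = E + T * F * T'"
  proof -
    have "(T + (E * F + E * F)) * T' = T * T' + (?X + ?X)"
      by (simp add: add_mult_distrib_mat[of _ n n _ _ n] del: assoc_mult_mat)
    moreover have "(E * T + T * F) * T' = E * (T * T') + T * F * T'"
      by (simp add: add_mult_distrib_mat[of _ n n _ _ n] assoc_mult_mat[of E n n T n T' n] del: assoc_mult_mat)
    ultimately show ?thesis using eqs(2) inv mult_one_mat[of E n n] by simp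
  qed
  then have "?tr (1\<^sub>m n) + (?tr ?X + ?tr ?X) = ?tr E + ?tr (T * F * T')"
    by (metis add_carrier_mat c mat_trace_add mc one_carrier_mat)
  moreover have "?tr (T * F * T') = ?tr F"
    using inv by (intro mat_trace_conjugate[OF comm]) auto
  moreover obtain m where m: "n = 2 * m + 1" using \<open>odd n\<close> oddE by blast
  have "?tr (1\<^sub>m n :: 'a mat) = (\<Sum>i<m. 1) + (\<Sum>i<m. 1) + 1"
  proof -
    have "(\<Sum>i<k + l. 1 :: 'a) = (\<Sum>i<k. 1) + (\<Sum>i<l. 1)" for k l :: nat
      by (induction l) (auto simp: ac_simps)
    then have "(\<Sum>i<m + m. 1 :: 'a) = (\<Sum>i<m. 1) + (\<Sum>i<m. 1)" .
    then show ?thesis by (simp add: mat_trace_def m mult_2 add.commute)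
  qed
  ultimately have "(\<Sum>i<m. 1) + (\<Sum>i<m. 1) + 1 + (?tr ?X + ?tr ?X) = ?tr E + ?tr E" by simp
  moreover have "(a - c - k) + (a - c - k) = 1" if "k + k + 1 + (c + c) = a + a" for a c k :: 'a
  proof -
    have "(a - c - k) + (a - c - k) = (a + a) - (k + k + (c + c))" by (simp add: algebra_simps)
    also have "\<dots> = 1" unfolding that[symmetric] by simp
    finally show ?thesis .
  qed
  ultimately obtain x :: 'a where "x + x = 1" by blast
  then have "x * (1 + 1) = 1" "(1 + 1) * x = 1" by (simp_all add: distrib_left distrib_right)
  then show ?thesis unfolding Units_class_ring by blast
qed

section \<open>Size 2 over a commutative ring, by determinants\<close>

context
  assumes comm: "\<And>x y :: 'a::{ring, monoid_mult}. x * y = y * x"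
begin

private lemma left_comm: "x * (y * z) = y * (x * z)" for x y z :: 'a
  by (metis comm mult.assoc)

text \<open>For an idempotent matrix E with entries \<open>a\<close>, \<open>b\<close>,
  \<open>c\<close>, \<open>d\<close>, determinant \<epsilon> and trace \<tau>, Cayley-Hamilton gives
  (1 - \<tau>) E = -\<epsilon>, which 1 - \<epsilon> annihilates. Multiplying E adj(E) = \<epsilon>
  by E gives \<epsilon> E = \<epsilon>, so E is the identity where \<epsilon> = 1.\<close>

private lemma idempotent_2x2:
  fixes a b c d :: 'a
  assumes "a * a + b * c = a" "a * b + b * d = b" "c * a + d * c = c" "c * b + d * d = d"
  defines "\<epsilon> \<equiv> a * d - b * c" and "\<tau> \<equiv> a + d"
  shows "\<epsilon> * a = \<epsilon>" "\<epsilon> * b = 0" "\<epsilon> * c = 0" "\<epsilon> * d = \<epsilon>" "\<epsilon> * \<epsilon> = \<epsilon>"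
    and "x \<in> {a, b, c, d} \<Longrightarrow> (1 - \<epsilon>) * ((1 - \<tau>) * x) = 0"
proof -
  note ac = comm[of b a] comm[of c a] comm[of d a] comm[of c b] comm[of d b] comm[of d c]
  have b: "\<tau> * b = b" and c: "\<tau> * c = c"
    using assms(2,3) by (simp_all add: \<tau>_def distrib_right ac)
  have a: "(1 - \<tau>) * a = - \<epsilon>" and d: "(1 - \<tau>) * d = - \<epsilon>"
    using assms(1,4) by (simp_all add: \<tau>_def \<epsilon>_def algebra_simps ac)
  have bc: "\<tau> * (b * c) = b * c" using b by (metis mult.assoc)
  have "\<epsilon> * a = a * a * d - b * c * a" by (simp add: \<epsilon>_def algebra_simps comm left_comm)
  also have "\<dots> = (a - b * c) * d - b * c * a" using assms(1) by (metis add_diff_cancel_right')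
  also have "\<dots> = a * d - \<tau> * (b * c)" by (simp add: \<tau>_def algebra_simps comm left_comm)
  finally show ea: "\<epsilon> * a = \<epsilon>" by (simp add: bc \<epsilon>_def)
  have "\<epsilon> * d = a * (d * d) - b * c * d" by (simp add: \<epsilon>_def algebra_simps comm left_comm)
  also have "\<dots> = a * (d - c * b) - b * c * d" using assms(4) by (metis add_diff_cancel_left')
  also have "\<dots> = a * d - \<tau> * (b * c)" by (simp add: \<tau>_def algebra_simps comm left_comm)
  finally show ed: "\<epsilon> * d = \<epsilon>" by (simp add: bc \<epsilon>_def)
  have e: "\<epsilon> = - ((1 - \<tau>) * a)" using a by simp
  have "\<epsilon> * b = - (a * (b - \<tau> * b))" "\<epsilon> * c = - (a * (c - \<tau> * c))"
    unfolding e by (simp_all add: algebra_simps comm left_comm)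
  then show eb: "\<epsilon> * b = 0" and ec: "\<epsilon> * c = 0" by (simp_all add: b c)
  have "\<epsilon> * \<epsilon> = \<epsilon> * a * d - \<epsilon> * b * c" by (simp add: \<epsilon>_def algebra_simps)
  then show ee: "\<epsilon> * \<epsilon> = \<epsilon>" by (simp add: ea eb ed)
  show "(1 - \<epsilon>) * ((1 - \<tau>) * x) = 0" if "x \<in> {a, b, c, d}"
  proof -
    have "(1 - \<tau>) * x = 0 \<or> (1 - \<tau>) * x = - \<epsilon>"
      using that a b c d by (auto simp: left_diff_distrib)
    then show ?thesis by (auto simp: left_diff_distrib ee)
  qed
qed

private lemma det_2x2_mult:
  fixes a b c d a' b' c' d' :: 'a
  shows "(a * a' + b * c') * (c * b' + d * d') - (a * b' + b * d') * (c * a' + d * c') =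
    (a * d - b * c) * (a' * d' - b' * c')"
  by (simp add: algebra_simps comm left_comm)

text \<open>
  Where \<open>E\<close> has rank one, so does \<open>F\<close>, and then \<open>det T - det (T - 1) = tr T - 1 = 1\<close>. Where
  \<open>E = F = 1\<close>, use \<open>1 = 2 - 1\<close>; the idempotent \<open>det E\<close> glues the two cases. The rank zero part is
  cut out by \<open>\<alpha>\<close>, which vanishes because \<open>T\<close> is invertible and \<open>\<alpha> T = 0\<close>.
\<close>

lemma one_sum_of_units_if_property_K_bar_comm:
  assumes K: "property_K_bar (matrix_ring TYPE('a) 2)"
  shows "\<exists>u\<in>Units class_ring. \<exists>v\<in>Units class_ring. u + v = (1 :: 'a)"
proof -
  obtain E F S S' T T' :: "'a mat"
    where c [simp]: "E \<in> carrier_mat 2 2" "F \<in> carrier_mat 2 2" "S \<in> carrier_mat 2 2" "S' \<in> carrier_mat 2 2"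
      "T \<in> carrier_mat 2 2" "T' \<in> carrier_mat 2 2"
    and idem: "E * E = E" "F * F = F"
    and inv: "S' * S = 1\<^sub>m 2" "S * S' = 1\<^sub>m 2" "T' * T = 1\<^sub>m 2" "T * T' = 1\<^sub>m 2"
    and T: "T = E + F" "T = S + 1\<^sub>m 2" and ES: "E * S = S * F"
    by (rule property_K_bar_matrix_ringE[OF K]) (rule that; assumption)
  have entry: "(A * B) $$ (i, j) = A $$ (i, 0) * B $$ (0, j) + A $$ (i, 1) * B $$ (1, j)"
    if "i < 2" "j < 2" "A \<in> carrier_mat 2 2" "B \<in> carrier_mat 2 2" for A B :: "'a mat" and i j
    using that by (auto simp: scalar_prod_def numeral_2_eq_2)
  define det where "det A = A $$ (0, 0) * A $$ (1, 1) - A $$ (0, 1) * A $$ (1, 0)" for A :: "'a mat"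
  have det_mult: "det (A * B) = det A * det B" if "A \<in> carrier_mat 2 2" "B \<in> carrier_mat 2 2" for A B :: "'a mat"
    unfolding det_def using that by (simp add: entry[OF _ _ that] det_2x2_mult del: index_mult_mat)
  have det_one: "det (1\<^sub>m 2) = 1" by (simp add: det_def)
  have dS: "det S * det S' = 1" and dT: "det T * det T' = 1"
    using det_mult[of S S'] det_mult[of T T'] inv det_one by simp_all
  define \<epsilon> \<tau> where "\<epsilon> = det E" and "\<tau> = E $$ (0, 0) + E $$ (1, 1)"
  have F: "det F = \<epsilon>" "F $$ (0, 0) + F $$ (1, 1) = \<tau>"
  proof -
    have "S * F * S' = E"
      using assoc_mult_mat[of E 2 2 S 2 S' 2] ES inv mult_one_mat[of E 2 2] by simp
    then have "mat_trace 2 E = mat_trace 2 F"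
      using mat_trace_conjugate[OF comm, of F 2 S S'] inv by simp
    then show "F $$ (0, 0) + F $$ (1, 1) = \<tau>" by (simp add: mat_trace_def \<tau>_def numeral_2_eq_2)
    have "det E * det S = det S * det F" using ES det_mult[of E S] det_mult[of S F] by simp
    then have "det F * (det S * det S') = det E * (det S * det S')"
      by (metis comm mult.assoc)
    then show "det F = \<epsilon>" by (simp add: dS \<epsilon>_def)
  qed
  have sq: "X $$ (i, 0) * X $$ (0, j) + X $$ (i, 1) * X $$ (1, j) = X $$ (i, j)"
    if "X * X = X" "X \<in> carrier_mat 2 2" "i < 2" "j < 2" for X :: "'a mat" and i j
    using entry[of i j X X] that by simp
  have id: "\<epsilon> * X $$ (0, 0) = \<epsilon>" "\<epsilon> * X $$ (0, 1) = 0" "\<epsilon> * X $$ (1, 0) = 0" "\<epsilon> * X $$ (1, 1) = \<epsilon>"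
    "\<epsilon> * \<epsilon> = \<epsilon>" "(1 - \<epsilon>) * ((1 - \<tau>) * X $$ (0, 0)) = 0" "(1 - \<epsilon>) * ((1 - \<tau>) * X $$ (0, 1)) = 0"
    if X: "X \<in> {E, F}" for X :: "'a mat"
  proof -
    have X': "X * X = X" "X \<in> carrier_mat 2 2" "det X = \<epsilon>" "X $$ (0, 0) + X $$ (1, 1) = \<tau>"
      using X idem F by (auto simp: \<epsilon>_def \<tau>_def)
    have lt: "(0 :: nat) < 2" "(1 :: nat) < 2" by simp_all
    note sq' = sq[OF X'(1,2)]
    note * = idempotent_2x2[OF sq'[OF lt(1) lt(1)] sq'[OF lt(1) lt(2)] sq'[OF lt(2) lt(1)] sq'[OF lt(2) lt(2)],
        folded det_def, unfolded X'(3,4)]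
    show "\<epsilon> * X $$ (0, 0) = \<epsilon>" "\<epsilon> * X $$ (0, 1) = 0" "\<epsilon> * X $$ (1, 0) = 0" "\<epsilon> * X $$ (1, 1) = \<epsilon>"
      "\<epsilon> * \<epsilon> = \<epsilon>" "(1 - \<epsilon>) * ((1 - \<tau>) * X $$ (0, 0)) = 0" "(1 - \<epsilon>) * ((1 - \<tau>) * X $$ (0, 1)) = 0"
      using * by auto
  qed
  define \<alpha> where "\<alpha> = (1 - \<epsilon>) * (1 - \<tau>)"
  have "\<alpha> = 0"
  proof -
    have "\<alpha> * T $$ (0, 0) = 0" "\<alpha> * T $$ (0, 1) = 0"
      using id(6,7)[of E] id(6,7)[of F] carrier_matD[OF c(2)] by (simp_all add: T(1) \<alpha>_def distrib_left mult.assoc)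
    \<comment> \<open>The (0, 0) entry of T T' = 1 recovers \<alpha> from its products with the
      first row of T, which vanish.\<close>
    moreover have "\<alpha> = \<alpha> * T $$ (0, 0) * T' $$ (0, 0) + \<alpha> * T $$ (0, 1) * T' $$ (1, 0)"
      using entry[of 0 0 T T'] inv by (simp add: mult.assoc distrib_left[symmetric])
    ultimately show ?thesis by simp
  qed
  have diff: "det T - det S = \<tau> + \<tau> - 1"
  proof -
    have S: "S $$ (0, 0) = T $$ (0, 0) - 1" "S $$ (1, 1) = T $$ (1, 1) - 1"
      "S $$ (0, 1) = T $$ (0, 1)" "S $$ (1, 0) = T $$ (1, 0)"
      using c by (simp_all add: T(2))
    then have "det T - det S = T $$ (0, 0) + T $$ (1, 1) - 1"
      unfolding det_def S by (simp add: algebra_simps)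
    also have "T $$ (0, 0) + T $$ (1, 1) = \<tau> + (F $$ (0, 0) + F $$ (1, 1))"
      using carrier_matD[OF c(2)] by (simp add: T(1) \<tau>_def)
    finally show ?thesis unfolding F(2) .
  qed
  \<comment> \<open>On the component cut out by \<epsilon>, T = 2 and hence det T = 4. So 2 is a
    unit there, with inverse 2 det T'.\<close>
  have eT: "\<epsilon> * det T = \<epsilon> + \<epsilon> + (\<epsilon> + \<epsilon>)"
  proof -
    have e: "\<epsilon> * T $$ (0, 0) = \<epsilon> + \<epsilon>" "\<epsilon> * T $$ (0, 1) = 0" "\<epsilon> * T $$ (1, 1) = \<epsilon> + \<epsilon>"
      using id[of E] id[of F] carrier_matD[OF c(2)] by (simp_all add: T(1) distrib_left)
    then show ?thesis
      by (simp add: det_def right_diff_distrib mult.assoc[symmetric] distrib_right)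
  qed
  \<comment> \<open>On the \<epsilon> component the units are 2 and -1; on the complementary one
    they are det T and -det S. By \<open>diff\<close> they add up to 1 - 2 \<alpha>.\<close>
  let ?u = "\<epsilon> + \<epsilon> + (1 - \<epsilon>) * det T" and ?v = "- (\<epsilon> + (1 - \<epsilon>) * det S)"
  have ee: "\<epsilon> * \<epsilon> = \<epsilon>" using id(5)[of E] by simp
  have ortho: "\<epsilon> * (1 - \<epsilon>) = 0" "(1 - \<epsilon>) * (1 - \<epsilon>) = 1 - \<epsilon>"
    by (simp_all add: algebra_simps ee)
  \<comment> \<open>The ring splits as a product along \<epsilon> and 1 - \<epsilon>, so products
    can be taken componentwise.\<close>
  have glue: "(\<epsilon> * x + (1 - \<epsilon>) * y) * (\<epsilon> * x' + (1 - \<epsilon>) * y') = \<epsilon> * (x * x') + (1 - \<epsilon>) * (y * y')"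
    for x y x' y' :: 'a
  proof -
    have "(\<epsilon> * x + (1 - \<epsilon>) * y) * (\<epsilon> * x' + (1 - \<epsilon>) * y') =
        \<epsilon> * \<epsilon> * (x * x') + (\<epsilon> * (1 - \<epsilon>)) * (x * y') + (\<epsilon> * (1 - \<epsilon>)) * (y * x') + (1 - \<epsilon>) * (1 - \<epsilon>) * (y * y')"
      by (simp only: distrib_left distrib_right) (simp add: comm left_comm add.assoc)
    then show ?thesis by (simp add: ortho ee)
  qed
  have "?u * (\<epsilon> * ((1 + 1) * det T') + (1 - \<epsilon>) * det T') = 1"
  proof -
    have "?u = \<epsilon> * (1 + 1) + (1 - \<epsilon>) * det T" by (simp add: distrib_left)
    then have "?u * (\<epsilon> * ((1 + 1) * det T') + (1 - \<epsilon>) * det T') =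
        \<epsilon> * ((1 + 1) * ((1 + 1) * det T')) + (1 - \<epsilon>) * (det T * det T')"
      using glue by simp
    also have "\<epsilon> * ((1 + 1) * ((1 + 1) * det T')) = \<epsilon> * det T * det T'"
      unfolding eT by (simp add: distrib_left distrib_right)
    finally show ?thesis by (simp add: mult.assoc dT)
  qed
  moreover have "?v * (- (\<epsilon> + (1 - \<epsilon>) * det S')) = 1"
    unfolding minus_mult_minus using glue[of 1 "det S" 1 "det S'"] by (simp add: dS)
  moreover have "?u + ?v = 1"
  proof -
    have "?u + ?v = \<epsilon> + (1 - \<epsilon>) * (det T - det S)" by (simp add: right_diff_distrib)
    also have "\<dots> = 1 - (\<alpha> + \<alpha>)" unfolding diff \<alpha>_def by (simp add: algebra_simps)
    finally show ?thesis by (simp add: \<open>\<alpha> = 0\<close>)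
  qed
  ultimately show ?thesis
    unfolding Bex_def Units_class_ring using comm by metis
qed

end

section \<open>Odd size over a local ring, by dimensions over the residues\<close>

lemma local_ring_nonunits:
  fixes J :: "'a::{ring, monoid_mult} set"
  assumes "local_ring (class_ring :: 'a ring)" and J: "J = - Units class_ring"
  shows "0 \<in> J" and "1 \<notin> J" and "\<And>x y. x \<in> J \<Longrightarrow> y \<in> J \<Longrightarrow> x + y \<in> J"
    and "\<And>x c. x \<in> J \<Longrightarrow> x * c \<in> J" and "\<And>x c. x \<in> J \<Longrightarrow> c * x \<in> J"
proof -
  have "ideal J (class_ring :: 'a ring)"
    using assms by (simp add: local_ring_def Compl_eq_Diff_UNIV)
  then interpret ideal J "class_ring :: 'a ring" .
  show "0 \<in> J" using additive_subgroup.zero_closed[OF is_additive_subgroup] by simp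
  show "1 \<notin> J" by (auto simp: J Units_class_ring)
  show "x + y \<in> J" if "x \<in> J" "y \<in> J" for x y using additive_subgroup.a_closed[OF is_additive_subgroup] that by simp
  show "x * c \<in> J" "c * x \<in> J" if "x \<in> J" for x c using I_r_closed I_l_closed that by simp_all
qed

text \<open>Column vectors are functions on all of \<open>nat\<close>, so that they form a type with
  an additive group structure. The value 0 from \<open>n\<close> on lets composition match matrix
  multiplication exactly.\<close>

definition mat_apply :: "nat \<Rightarrow> 'a::ring mat \<Rightarrow> (nat \<Rightarrow> 'a) \<Rightarrow> nat \<Rightarrow> 'a" where
  "mat_apply n A x = (\<lambda>i. if i < n then \<Sum>j<n. A $$ (i, j) * x j else 0)"

lemma mat_apply_mult:
  assumes "A \<in> carrier_mat n n" "B \<in> carrier_mat n n"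
  shows "mat_apply n A (mat_apply n B x) = mat_apply n (A * B) x"
proof
  fix i
  show "mat_apply n A (mat_apply n B x) i = mat_apply n (A * B) x i"
  proof (cases "i < n")
    case True
    have "(\<Sum>j<n. A $$ (i, j) * (\<Sum>k<n. B $$ (j, k) * x k)) =
        (\<Sum>k<n. \<Sum>j<n. A $$ (i, j) * B $$ (j, k) * x k)"
      by (subst sum.swap) (simp add: sum_distrib_left mult.assoc)
    then show ?thesis
      using assms True by (simp add: mat_apply_def scalar_prod_def atLeast0LessThan sum_distrib_right)
  qed (simp add: mat_apply_def)
qed

lemma mat_apply_add:
  assumes "A \<in> carrier_mat n n" "B \<in> carrier_mat n n"
  shows "mat_apply n (A + B) x = mat_apply n A x + mat_apply n B x"
  using assms by (auto simp: mat_apply_def distrib_right sum.distrib)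

lemma mat_apply_one:
  "i < n \<Longrightarrow> mat_apply n (1\<^sub>m n :: 'a::{ring, monoid_mult} mat) x i = x i"
  by (simp add: mat_apply_def if_distrib[of "\<lambda>y. y * _"] cong: if_cong)

text \<open>If 2 is a nonunit, it vanishes in the residue division ring. There W = T S' conjugates E
  to 1 - E, so \<open>even_card_basis\<close> makes n even.\<close>

lemma two_unit_if_property_K_bar_local:
  assumes loc: "local_ring (class_ring :: 'a::{ring, monoid_mult} ring)"
    and K: "property_K_bar (matrix_ring TYPE('a) n)" and "odd n"
  shows "(1 + 1 :: 'a) \<in> Units class_ring"
proof (rule ccontr)
  assume two: "(1 + 1 :: 'a) \<notin> Units class_ring"
  define J :: "'a set" where "J = - Units class_ring"
  note J = local_ring_nonunits[OF loc J_def]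
  \<comment> \<open>The quotient by \<open>N\<close> is the space of n-tuples over the residue ring,
    coordinates from \<open>n\<close> on being ignored. Scalars act on the right, so left
    multiplication by a matrix is linear.\<close>
  define N where "N = {x :: nat \<Rightarrow> 'a. \<forall>i<n. x i \<in> J}"
  define sc where "sc x c = (\<lambda>i. x i * c)" for x :: "nat \<Rightarrow> 'a" and c
  interpret residue_module sc J N
  proof
    show "\<exists>d. c * d = 1" if "c \<notin> J" for c
      using that Units_class_ring[of c] unfolding J_def by auto
  qed (auto simp: sc_def N_def algebra_simps J)
  obtain E F S S' T T' :: "'a mat"
    where c [simp]: "E \<in> carrier_mat n n" "F \<in> carrier_mat n n" "S \<in> carrier_mat n n" "S' \<in> carrier_mat n n"
      "T \<in> carrier_mat n n" "T' \<in> carrier_mat n n"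
    and idem: "E * E = E"
    and inv: "S' * S = 1\<^sub>m n" "S * S' = 1\<^sub>m n" "T' * T = 1\<^sub>m n" "T * T' = 1\<^sub>m n"
    and eqs: "E * S = S * F" "T + (E * F + E * F) = E * T + T * F"
    by (rule property_K_bar_matrix_ringE[OF K]) (rule that; assumption)
  note mc [simp] = mult_carrier_mat[of _ n n _ n]
  let ?L = "mat_apply n"
  have lin: "linear (?L A)" for A
  proof -
    have "(\<Sum>j<n. A $$ (i, j) * x j) \<in> J" if "\<forall>j<n. x j \<in> J" for x i
    proof -
      have "(\<Sum>j<k. A $$ (i, j) * x j) \<in> J" if "k \<le> n" for k
        using that \<open>\<forall>j<n. x j \<in> J\<close> by (induction k) (auto simp: J)
      then show ?thesis by simp
    qed
    then show ?thesis
      unfolding linear_def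
      by (auto simp: mat_apply_def sc_def N_def fun_eq_iff distrib_left sum.distrib
          sum_distrib_right mult.assoc)
  qed
  have L_one: "?L A (?L B x) - x \<in> N"
    if "A * B = 1\<^sub>m n" "A \<in> carrier_mat n n" "B \<in> carrier_mat n n" for A B x
    using that by (simp add: mat_apply_mult N_def mat_apply_one J)
  \<comment> \<open>S' conjugates E to F, and T conjugates F to 1 - E modulo 2.\<close>
  define W W' where "W = T * S'" and "W' = S * T'"
  have cW [simp]: "W \<in> carrier_mat n n" "W' \<in> carrier_mat n n" by (simp_all add: W_def W'_def)
  have WW: "W * W' = 1\<^sub>m n" "W' * W = 1\<^sub>m n"
  proof -
    have "W * W' = T * ((S' * S) * T')"
      using assoc_mult_mat[of T n n S' n W' n] assoc_mult_mat[of S' n n S n T' n] cW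
      unfolding W_def W'_def by simp
    then show "W * W' = 1\<^sub>m n" using inv one_mult_mat[of T' n n] by simp
    have "W' * W = S * ((T' * T) * S')"
      using assoc_mult_mat[of S n n T' n W n] assoc_mult_mat[of T' n n T n S' n] cW
      unfolding W_def W'_def by simp
    then show "W' * W = 1\<^sub>m n" using inv one_mult_mat[of S' n n] by simp
  qed
  let ?Z = "E * F * S'"
  have swap: "W + (?Z + ?Z) = E * W + W * E"
  proof -
    have "F * S' = S' * E"
    proof -
      have "S' * E * S * S' = S' * S * F * S'"
        using eqs(1) assoc_mult_mat[of S' n n E n S n] assoc_mult_mat[of S' n n S n F n] by simp
      then show ?thesis
        using inv one_mult_mat[of F n n] mult_one_mat[of "S' * E" n n]
          assoc_mult_mat[of "S' * E" n n S n S' n] by simp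
    qed
    then have WE: "T * F * S' = W * E"
      unfolding W_def using assoc_mult_mat[of T n n F n S' n] assoc_mult_mat[of T n n S' n E n] by simp
    have "(T + (E * F + E * F)) * S' = W + (?Z + ?Z)"
      by (simp add: add_mult_distrib_mat[of _ n n _ _ n] W_def del: assoc_mult_mat)
    moreover have "(E * T + T * F) * S' = E * W + T * F * S'"
      by (simp add: add_mult_distrib_mat[of _ n n _ _ n] assoc_mult_mat[of E n n T n S' n] W_def del: assoc_mult_mat)
    ultimately show ?thesis using eqs(2) WE by simp
  qed
  have L_swap: "?L W (?L E x) + ?L E (?L W x) - ?L W x \<in> N" for x
  proof -
    have "?L W x + (?L ?Z x + ?L ?Z x) = ?L E (?L W x) + ?L W (?L E x)"
      using arg_cong[OF swap, of "\<lambda>A. ?L A x"] by (simp add: mat_apply_add mat_apply_mult)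
    then have "?L W (?L E x) + ?L E (?L W x) - ?L W x = ?L ?Z x + ?L ?Z x"
      by (metis add.commute add_diff_cancel_left')
    moreover have "y + y \<in> J" for y
      using J(5)[of "1 + 1" y] two by (simp add: J_def distrib_left)
    ultimately show ?thesis by (simp add: N_def)
  qed
  define u :: "nat \<Rightarrow> nat \<Rightarrow> 'a" where "u i = (\<lambda>j. if j = i then 1 else 0)" for i
  let ?X = "u ` {..<n}"
  have inj: "inj_on u {..<n}"
    by (rule inj_onI) (metis J(1,2) u_def)
  have "indep ?X"
    unfolding indep_def
  proof
    fix x assume "x \<in> ?X"
    then obtain i where i: "i < n" "x = u i" by blast
    \<comment> \<open>Coordinate i of any combination of the other unit vectors lies in
      \<open>J\<close>, whereas that of \<open>u i\<close> is 1.\<close>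
    have "y i \<in> J" if "y \<in> span (?X - {x})" for y
      using that
    proof induction
      case (base y)
      then show ?case using i by (auto simp: u_def J)
    qed (use i in \<open>auto simp: J N_def sc_def\<close>)
    moreover have "x i = 1" by (simp add: i u_def)
    ultimately show "x \<notin> span (?X - {x})" using J(2) by metis
  qed
  moreover have "x \<in> span ?X" for x
  proof -
    \<comment> \<open>Coordinates are added one at a time; those from \<open>n\<close> on are
      absorbed by \<open>N\<close>.\<close>
    have "(\<lambda>j. if j < k then x j else 0) \<in> span ?X" if "k \<le> n" for k
      using that
    proof (induction k)
      case 0
      show ?case by (rule span.null) (simp add: N_def J)
    next
      case (Suc k)
      have "(\<lambda>j. if j < Suc k then x j else 0) = (\<lambda>j. if j < k then x j else 0) + sc (u k) (x k)"
        by (auto simp: sc_def u_def less_Suc_eq)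
      moreover have "u k \<in> span ?X" using Suc.prems by (intro span.base) auto
      ultimately show ?case using Suc by (simp add: span.add span.scale)
    qed
    from this[of n] show ?thesis
      by (intro span_cong[of x "\<lambda>j. if j < n then x j else 0"]) (simp_all add: N_def J)
  qed
  ultimately have "even (card ?X)"
    using lin L_one WW idem L_swap
    by (intro even_card_basis[of ?X "?L E" "?L W" "?L W'"]) (simp_all add: mat_apply_mult)
  then show False using \<open>odd n\<close> inj by (simp add: card_image)
qed

section \<open>Size 2 over a local ring, by reduction to the field with two elements\<close>

lemma property_K_bar_matrix_ring_hom:
  fixes \<phi> :: "'a::{ring, monoid_mult} \<Rightarrow> 'b::{ring, monoid_mult}"
  assumes add: "\<And>x y. \<phi> (x + y) = \<phi> x + \<phi> y" and mult: "\<And>x y. \<phi> (x * y) = \<phi> x * \<phi> y"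
    and one: "\<phi> 1 = 1"
    and K: "property_K_bar (matrix_ring TYPE('a) n)"
  shows "property_K_bar (matrix_ring TYPE('b) n)"
proof -
  have zero: "\<phi> 0 = 0" using add[of 0 0] by simp
  have sum: "\<phi> (\<Sum>i\<in>I. f i) = (\<Sum>i\<in>I. \<phi> (f i))" for f and I :: "nat set"
    by (induction I rule: infinite_finite_induct) (simp_all add: zero add)
  have h_mult: "map_mat \<phi> (A * B) = map_mat \<phi> A * map_mat \<phi> B"
    and h_add: "map_mat \<phi> (A + B) = map_mat \<phi> A + map_mat \<phi> B"
    if "A \<in> carrier_mat n n" "B \<in> carrier_mat n n" for A B
    using that by (auto intro!: eq_matI simp: scalar_prod_def sum mult add)
  have h_one: "map_mat \<phi> (1\<^sub>m n) = 1\<^sub>m n"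
    by (intro eq_matI) (auto simp: one zero)
  from K obtain E F where EF: "E \<in> idempotents (matrix_ring TYPE('a) n)"
    "F \<in> idempotents (matrix_ring TYPE('a) n)" and u: "E * F + F * E \<in> Units (matrix_ring TYPE('a) n)"
    unfolding property_K_bar_def by (auto simp: matrix_ring_def)
  have c [simp]: "E \<in> carrier_mat n n" "F \<in> carrier_mat n n" and idem: "E * E = E" "F * F = F"
    using EF by (auto simp: idempotents_def matrix_ring_def)
  obtain B where B: "B \<in> carrier_mat n n" "B * (E * F + F * E) = 1\<^sub>m n" "(E * F + F * E) * B = 1\<^sub>m n"
    using u unfolding Units_matrix_ring by blast
  note mc = mult_carrier_mat[of _ n n _ n]
  show ?thesis
  proof (rule property_K_bar_matrix_ringI)
    show "map_mat \<phi> E * map_mat \<phi> E = map_mat \<phi> E" "map_mat \<phi> F * map_mat \<phi> F = map_mat \<phi> F"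
      using h_mult[of E E] h_mult[of F F] idem by simp_all
    have *: "map_mat \<phi> (E * F + F * E) = map_mat \<phi> E * map_mat \<phi> F + map_mat \<phi> F * map_mat \<phi> E"
      using h_add[of "E * F" "F * E"] h_mult[of E F] h_mult[of F E] by (simp add: mc)
    have **: "E * F + F * E \<in> carrier_mat n n" by (simp add: mc)
    show "map_mat \<phi> B * (map_mat \<phi> E * map_mat \<phi> F + map_mat \<phi> F * map_mat \<phi> E) = 1\<^sub>m n"
      unfolding *[symmetric] h_mult[OF B(1) **, symmetric] B(2) h_one ..
    show "(map_mat \<phi> E * map_mat \<phi> F + map_mat \<phi> F * map_mat \<phi> E) * map_mat \<phi> B = 1\<^sub>m n"
      unfolding *[symmetric] h_mult[OF ** B(1), symmetric] B(3) h_one ..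
  qed (use B(1) in simp_all)
qed

text \<open>
  If \<open>1\<close> is not a sum of two units, then \<open>1 - c\<close> is a nonunit for every unit \<open>c\<close>, so the residue
  ring has two elements.
\<close>

lemma one_sum_of_units_if_property_K_bar_local:
  assumes loc: "local_ring (class_ring :: 'a::{ring, monoid_mult} ring)"
    and K: "property_K_bar (matrix_ring TYPE('a) 2)"
  shows "\<exists>u\<in>Units class_ring. \<exists>v\<in>Units class_ring. u + v = (1 :: 'a)"
proof (rule ccontr)
  assume no: "\<not> ?thesis"
  define J :: "'a set" where "J = - Units class_ring"
  note J = local_ring_nonunits[OF loc J_def]
  have compl: "1 - x \<in> J" if "x \<notin> J" for x
    using no that unfolding J_def by (metis ComplI ComplD add_diff_cancel_left' diff_add_cancel add.commute)
  have neg: "- x \<in> J" if "x \<in> J" for x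
    using J(4)[OF that, of "- 1"] by simp
  have diff: "x - y \<in> J" if "x \<in> J" "y \<in> J" for x y
    using J(3)[OF that(1) neg[OF that(2)]] by simp
  \<comment> \<open>-1 is a unit, so 1 - (-1) is a nonunit by \<open>compl\<close>.\<close>
  have two: "1 + 1 \<in> J"
    using compl[of "- 1"] neg[of "- 1"] J(2) by auto
  \<comment> \<open>The residue map, whose target is the field with two elements. For units x and y,
    additivity rests on x + y = 2 - (1 - x) - (1 - y).\<close>
  define \<phi> :: "'a \<Rightarrow> bit" where "\<phi> x = (if x \<in> J then 0 else 1)" for x
  have "property_K_bar (matrix_ring TYPE(bit) 2)"
  proof (rule property_K_bar_matrix_ring_hom[OF _ _ _ K])
    show "\<phi> (x + y) = \<phi> x + \<phi> y" for x y
    proof (cases "x \<in> J"; cases "y \<in> J")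
      assume "x \<notin> J" "y \<notin> J"
      then have "(1 + 1) - (1 - x) - (1 - y) \<in> J" by (intro diff two compl)
      moreover have "(1 + 1) - (1 - x) - (1 - y) = x + y" by simp
      ultimately have "x + y \<in> J" by metis
      then show ?thesis using \<open>x \<notin> J\<close> \<open>y \<notin> J\<close> by (simp add: \<phi>_def)
    next
      assume *: "x \<in> J" "y \<notin> J"
      then show ?thesis using diff[of "x + y" x] by (auto simp: \<phi>_def)
    next
      assume *: "x \<notin> J" "y \<in> J"
      then show ?thesis using diff[of "x + y" y] by (auto simp: \<phi>_def)
    qed (simp add: \<phi>_def J)
    show "\<phi> (x * y) = \<phi> x * \<phi> y" for x y
    proof (cases "x \<in> J")
      case False
      then obtain x' where "x' * x = 1" unfolding J_def using Units_class_ring by blast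
      then have "y = x' * (x * y)" by (simp add: mult.assoc[symmetric])
      then have "x * y \<in> J \<longleftrightarrow> y \<in> J" using J(5) by metis
      then show ?thesis using False by (simp add: \<phi>_def)
    qed (simp add: \<phi>_def J)
    show "\<phi> 1 = 1" by (simp add: \<phi>_def J)
  qed
  \<comment> \<open>The commutative case applies to the two-element field, whose only unit is 1,
    although 1 + 1 = 0 there.\<close>
  then obtain u v :: bit where "u \<in> Units class_ring" "v \<in> Units class_ring" "u + v = 1"
    using one_sum_of_units_if_property_K_bar_comm[OF mult.commute] by blast
  moreover have "(0 :: bit) \<notin> Units class_ring"
    unfolding Units_class_ring by simp
  then have "x = 1" if "x \<in> Units class_ring" for x :: bit
    using that by (cases x) simp_all
  ultimately show False by fastforce
qed

section \<open>The construction in size 2 and the equivalence\<close>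

lemma property_K_bar_if_one_sum_of_units:
  fixes u v :: "'a::{ring, monoid_mult}"
  assumes "u \<in> Units class_ring" and "v \<in> Units class_ring" and "u + v = 1"
  shows "property_K_bar (matrix_ring TYPE('a) 2)"
proof -
  \<comment> \<open>Regarding units as 1 by 1 matrices makes this the case m = 1 of
    \<open>property_K_bar_double\<close>.\<close>
  let ?M = "\<lambda>x. mat 1 1 (\<lambda>_. x)"
  have "?M x \<in> Units (matrix_ring TYPE('a) 1)" if "x \<in> Units class_ring" for x :: 'a
  proof -
    from that obtain y where "y * x = 1" "x * y = 1" unfolding Units_class_ring by blast
    then have "?M y * ?M x = 1\<^sub>m 1" "?M x * ?M y = 1\<^sub>m 1"
      by (auto intro!: eq_matI simp: scalar_prod_def)
    then show ?thesis
      unfolding Units_matrix_ring by (intro conjI bexI[of _ "?M y"]) auto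
  qed
  moreover have "?M u + ?M v = 1\<^sub>m 1"
    using assms(3) by (intro eq_matI) auto
  ultimately show ?thesis
    using property_K_bar_double[of "?M u" 1 "?M v"] assms by (simp add: numeral_2_eq_2)
qed

theorem theoremD:
  fixes n :: nat
  assumes "local_ring (class_ring :: 'a::{ring, monoid_mult} ring) \<or> cring (class_ring :: 'a ring)"
    and "n \<ge> 1"
  shows "property_K_bar (matrix_ring TYPE('a) n) \<longleftrightarrow>
    (n \<ge> 4 \<and> even n) \<or>
    (n = 2 \<and> (1::'a) \<in> Units class_ring <+>\<^bsub>class_ring\<^esub> Units class_ring) \<or>
    (odd n \<and> (1 + 1 :: 'a) \<in> Units class_ring)"
proof -
  have sum_iff: "(1::'a) \<in> Units class_ring <+>\<^bsub>class_ring\<^esub> Units class_ring \<longleftrightarrow>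
      (\<exists>u\<in>Units class_ring. \<exists>v\<in>Units class_ring. u + v = (1 :: 'a))"
    by (auto simp: set_add_def' eq_commute[of 1])
  have comm: "x * y = y * x" if "cring (class_ring :: 'a ring)" for x y :: 'a
    using cring.cring_simprules(14)[OF that, of x y] by simp
  show ?thesis
  proof
    assume K: "property_K_bar (matrix_ring TYPE('a) n)"
    show "(n \<ge> 4 \<and> even n) \<or>
      (n = 2 \<and> (1::'a) \<in> Units class_ring <+>\<^bsub>class_ring\<^esub> Units class_ring) \<or>
      (odd n \<and> (1 + 1 :: 'a) \<in> Units class_ring)"
    proof (cases "odd n")
      case True
      then have "(1 + 1 :: 'a) \<in> Units class_ring"
        using assms(1) K two_unit_if_property_K_bar_local two_unit_if_property_K_bar_comm comm by blast
      with True show ?thesis by blast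
    next
      case False
      then obtain m where m: "n = 2 * m" by blast
      show ?thesis
      proof (cases "n = 2")
        case True
        then have "\<exists>u\<in>Units class_ring. \<exists>v\<in>Units class_ring. u + v = (1 :: 'a)"
          using assms(1) K one_sum_of_units_if_property_K_bar_local
            one_sum_of_units_if_property_K_bar_comm comm by blast
        with True show ?thesis by (simp add: sum_iff)
      next
        case False
        then show ?thesis using m assms(2) by simp
      qed
    qed
  next
    assume "(n \<ge> 4 \<and> even n) \<or>
      (n = 2 \<and> (1::'a) \<in> Units class_ring <+>\<^bsub>class_ring\<^esub> Units class_ring) \<or>
      (odd n \<and> (1 + 1 :: 'a) \<in> Units class_ring)"
    then consider (even) "n \<ge> 4" "even n"
      | (two) "n = 2" "\<exists>u\<in>Units class_ring. \<exists>v\<in>Units class_ring. u + v = (1 :: 'a)"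
      | (odd) "(1 + 1 :: 'a) \<in> Units class_ring"
      unfolding sum_iff by blast
    then show "property_K_bar (matrix_ring TYPE('a) n)"
    proof cases
      case even
      then obtain m where m: "n = m + m" "m \<ge> 2" by (elim evenE) (simp add: mult_2)
      obtain U V :: "'a mat" where "U \<in> Units (matrix_ring TYPE('a) m)" "V \<in> Units (matrix_ring TYPE('a) m)"
        "U + V = 1\<^sub>m m"
        using one_mat_sum_of_units m(2) by blast
      then show ?thesis unfolding m(1) by (rule property_K_bar_double)
    next
      case two
      then show ?thesis using property_K_bar_if_one_sum_of_units by blast
    next
      case odd
      then show ?thesis by (rule property_K_bar_if_two_unit)
    qed
  qed
qed

end
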